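(* The functor $\mathrm{Cell}:\mathsf{Comp}\to\mathsf{Glob}$, sending a computad to its globular set of cells, is right adjoint to the functor $\mathrm{Free}:\mathsf{Glob}\to\mathsf{Comp}$, sending a globular set to the free computad on it.
   Context: **Globular sets and Batanin trees.** A globular set $X$ consists of sets $X_n$ ($n\in\mathbb N$) and maps $\mathrm{src},\mathrm{tgt}:X_{n+1}\to X_n$ with $\mathrm{src}\,\mathrm{src}=\mathrm{src}\,\mathrm{tgt}$, $\mathrm{tgt}\,\mathrm{src}=\mathrm{tgt}\,\mathrm{tgt}$; $\mathsf{Glob}$ is their category. The set of Batanin trees is inductively generated by: for every finite (possibly empty) list $[B_1,\dots,B_m]$ of trees, a tree $\mathrm{br}[B_1,\dots,B_m]$. $\dim\mathrm{br}[\,]=0$ and otherwise $\dim\mathrm{br}[B_1,\dots,B_m]=1+\max_i\dim B_i$. The globular set $\mathrm{Pos}(B)$ of positions is inductively generated by: $\mathrm{init}\in\mathrm{Pos}_0(B)$ for every $B$; $\mathrm{inr}(p)\in\mathrm{Pos}_n(\mathrm{br}[B,B_1,\dots,B_m])$ for $p\in\mathrm{Pos}_n(\mathrm{br}[B_1,\dots,B_m])$; $\mathrm{inl}(q)\in\mathrm{Pos}_{n+1}(\mathrm{br}[B,B_1,\dots,B_m])$ for $q\in\mathrm{Pos}_n(B)$. Source and target: $\mathrm{src}(\mathrm{inr}\,p)=\mathrm{inr}(\mathrm{src}\,p)$, $\mathrm{tgt}(\mathrm{inr}\,p)=\mathrm{inr}(\mathrm{tgt}\,p)$; if $q$ has dimension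 $0$, $\mathrm{src}(\mathrm{inl}\,q)=\mathrm{init}$ and $\mathrm{tgt}(\mathrm{inl}\,q)=\mathrm{inr}(\mathrm{init})$; otherwise $\mathrm{src}(\mathrm{inl}\,q)=\mathrm{inl}(\mathrm{src}\,q)$, $\mathrm{tgt}(\mathrm{inl}\,q)=\mathrm{inl}(\mathrm{tgt}\,q)$. We write $B$ for $\mathrm{Pos}(B)$. A position $p\in\mathrm{Pos}_n(B)$ is source (resp. target) boundary if it is not the target (resp. source) of any $(n+1)$-position; $\partial^s_n(B)$, $\partial^t_n(B)$ are the sets of source, target boundary $n$-positions. **Computads.** By induction on $n$ one defines categories $\mathsf{Comp}_n$, functors $u_n:\mathsf{Comp}_n\to\mathsf{Comp}_{n-1}$ and $\mathrm{Cell}_n,\mathrm{Sphere}_n:\mathsf{Comp}_n\to\mathsf{Set}$, a natural transformation $\mathrm{bdry}_n:\mathrm{Cell}_n\Rightarrow\mathrm{Sphere}_{n-1}u_n$, and, for globular sets $X$, computads $\mathrm{Free}_nX$ and spheres $\mathrm{ps}_{n,X}(a,b)\in\mathrm{Sphere}_n(\mathrm{Free}_nX)$ for $a,b\in X_n$ with common source and target. $\mathsf{Comp}_{-1}$ is the terminal category and $\mathrm{Sphere}_{-1}$ is a singleton. *$n=0$:* $\mathsf{Comp}_0=\mathsf{Set}$, $\mathrm{Cell}_0=\mathrm{id}$, $\mathrm{Sphere}_0(C)=C\times C$, $\mathrm{Free}_0X=X_0$, $\mathrm{ps}_{0,X}(a,b)=(a,b)$, $\mathrm{supp}(c)=\{c\}$;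 a $0$-sphere $(a,b)$ of $\mathrm{Free}_0B$ is full iff $a$ is source boundary and $b$ is target boundary. *$n>0$:* an $n$-computad is $C=(C_{n-1},V_n^C,\phi_n^C)$ with $C_{n-1}\in\mathsf{Comp}_{n-1}$, a set $V_n^C$ of generators and $\phi_n^C:V_n^C\to\mathrm{Sphere}_{n-1}(C_{n-1})$. $\mathrm{Free}_nX=(\mathrm{Free}_{n-1}X,X_n,x\mapsto\mathrm{ps}_{n-1,X}(\mathrm{src}\,x,\mathrm{tgt}\,x))$. Mutually inductively: a homomorphism $\sigma:D\to C$ is a pair of $\sigma_{n-1}:D_{n-1}\to C_{n-1}$ and $\sigma_V:V_n^D\to\mathrm{Cell}_n(C)$ with $\mathrm{bdry}_n\sigma_V=\mathrm{Sphere}_{n-1}(\sigma_{n-1})\phi_n^D$; $\mathrm{Cell}_n(C)$ is generated by $\mathrm{var}\,v$ for $v\in V_n^C$ and $\mathrm{coh}(B,A,\tau)$ for $B$ a Batanin tree with $\dim B\le n$, $A$ a full sphere in $\mathrm{Sphere}_{n-1}(\mathrm{Free}_{n-1}B)$ and $\tau:\mathrm{Free}_nB\to C$ a homomorphism; $\mathrm{bdry}_n(\mathrm{var}\,v)=\phi_n^C(v)$, $\mathrm{bdry}_n(\mathrm{coh}(B,A,\tau))=\mathrm{Sphere}_{n-1}(\tau_{n-1})(A)$. Action and composition: $\mathrm{Cell}_n(\sigma)(\mathrm{var}\,v)=\sigma_V(v)$, $\mathrm{Cell}_n(\sigma)(\mathrm{coh}(B,A,\tau))=\mathrm{coh}(B,A,\sigma\circ\tau)$,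 $\sigma\circ\tau=(\sigma_{n-1}\circ\tau_{n-1},\mathrm{Cell}_n(\sigma)\circ\tau_V)$. $\mathrm{Sphere}_n(C)$ is the set of triples $(A,a,b)$ with $a,b\in\mathrm{Cell}_n(C)$, $\mathrm{bdry}_n a=\mathrm{bdry}_n b=A$; $\mathrm{pr}_1,\mathrm{pr}_2$ pick $a,b$. $\mathrm{ps}_{n,X}(p,q)=(\mathrm{ps}_{n-1,X}(\mathrm{src}\,p,\mathrm{tgt}\,p),\mathrm{var}\,p,\mathrm{var}\,q)$. $\mathrm{supp}(\mathrm{var}\,v)=\{v\}$, $\mathrm{supp}(\mathrm{coh}(B,A,\tau))=\bigcup_{p\in\mathrm{Pos}_n(B)}\mathrm{supp}(\tau_V(p))$. $(A,a,b)\in\mathrm{Sphere}_n(\mathrm{Free}_nB)$ is full iff $A$ is full, $\mathrm{supp}(a)=\partial_n^s(B)$ and $\mathrm{supp}(b)=\partial_n^t(B)$. $\mathsf{Comp}$ is the limit of the $u_n$; its objects $C=(C_n)_n$ are computads. **The functors.** $\mathrm{Free}$ sends $X$ to $(\mathrm{Free}_nX)_n$, and $f:X\to Y$ to the homomorphism given by $f_0$ in dimension $0$ and by $x\mapsto\mathrm{var}\,f(x)$ in positive dimensions. $\mathrm{Cell}(C)$ is the globular set with $n$-cells $\mathrm{Cell}_n(C_n)$, $\mathrm{src}=\mathrm{pr}_1\mathrm{bdry}_n$, $\mathrm{tgt}=\mathrm{pr}_2\mathrm{bdry}_n$, functorial via $\mathrm{Cell}_n(\sigma_n)$. *)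

theory Defs
  imports Main "HOL-Library.FuncSet" "HOL-Library.Finite_Map"
begin

section \<open>Categories, functors, adjunctions\<close>

text \<open>
  Hom-sets of different pairs of objects need not be disjoint, so composition and the action of
  a functor on arrows take the objects as arguments.  For \<open>f\<close> from \<open>x\<close> to \<open>y\<close> and \<open>g\<close> from \<open>y\<close>
  to \<open>z\<close>, the composite of \<open>g\<close> after \<open>f\<close> is \<open>cmp C x y z g f\<close>.
\<close>

record ('o, 'a) cat =
  ob :: "'o set"
  hom :: "'o \<Rightarrow> 'o \<Rightarrow> 'a set"
  idn :: "'o \<Rightarrow> 'a"
  cmp :: "'o \<Rightarrow> 'o \<Rightarrow> 'o \<Rightarrow> 'a \<Rightarrow> 'a \<Rightarrow> 'a"

definition is_category :: "('o, 'a) cat \<Rightarrow> bool" where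
  "is_category C \<longleftrightarrow>
     (\<forall>x\<in>ob C. idn C x \<in> hom C x x) \<and>
     (\<forall>x\<in>ob C. \<forall>y\<in>ob C. \<forall>z\<in>ob C. \<forall>f\<in>hom C x y. \<forall>g\<in>hom C y z.
        cmp C x y z g f \<in> hom C x z) \<and>
     (\<forall>x\<in>ob C. \<forall>y\<in>ob C. \<forall>f\<in>hom C x y.
        cmp C x x y f (idn C x) = f \<and> cmp C x y y (idn C y) f = f) \<and>
     (\<forall>w\<in>ob C. \<forall>x\<in>ob C. \<forall>y\<in>ob C. \<forall>z\<in>ob C.
        \<forall>f\<in>hom C w x. \<forall>g\<in>hom C x y. \<forall>h\<in>hom C y z.
        cmp C w x z (cmp C x y z h g) f = cmp C w y z h (cmp C w x y g f))"

record ('o, 'a, 'p, 'b) func =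
  on_ob :: "'o \<Rightarrow> 'p"
  on_hom :: "'o \<Rightarrow> 'o \<Rightarrow> 'a \<Rightarrow> 'b"

definition is_functor ::
  "('o, 'a) cat \<Rightarrow> ('p, 'b) cat \<Rightarrow> ('o, 'a, 'p, 'b) func \<Rightarrow> bool" where
  "is_functor C D F \<longleftrightarrow>
     is_category C \<and> is_category D \<and>
     (\<forall>x\<in>ob C. on_ob F x \<in> ob D) \<and>
     (\<forall>x\<in>ob C. \<forall>y\<in>ob C. \<forall>f\<in>hom C x y. on_hom F x y f \<in> hom D (on_ob F x) (on_ob F y)) \<and>
     (\<forall>x\<in>ob C. on_hom F x x (idn C x) = idn D (on_ob F x)) \<and>
     (\<forall>x\<in>ob C. \<forall>y\<in>ob C. \<forall>z\<in>ob C. \<forall>f\<in>hom C x y. \<forall>g\<in>hom C y z.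
        on_hom F x z (cmp C x y z g f) =
        cmp D (on_ob F x) (on_ob F y) (on_ob F z) (on_hom F y z g) (on_hom F x y f))"

text \<open>
  \<open>G\<close>, from \<open>D\<close> to \<open>C\<close>, is right adjoint to \<open>F\<close>, from \<open>C\<close> to \<open>D\<close>: there is a bijection between
  arrows from \<open>F x\<close> to \<open>y\<close> and arrows from \<open>x\<close> to \<open>G y\<close>, natural in \<open>x\<close> and \<open>y\<close>.
\<close>

definition is_right_adjoint ::
  "('o, 'a) cat \<Rightarrow> ('p, 'b) cat \<Rightarrow> ('p, 'b, 'o, 'a) func \<Rightarrow> ('o, 'a, 'p, 'b) func \<Rightarrow> bool" where
  "is_right_adjoint C D G F \<longleftrightarrow>
     is_functor C D F \<and> is_functor D C G \<and>
     (\<exists>\<Phi>. (\<forall>x\<in>ob C. \<forall>y\<in>ob D.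
              bij_betw (\<Phi> x y) (hom D (on_ob F x) y) (hom C x (on_ob G y))) \<and>
           (\<forall>x\<in>ob C. \<forall>x'\<in>ob C. \<forall>y\<in>ob D. \<forall>y'\<in>ob D.
              \<forall>f\<in>hom C x' x. \<forall>g\<in>hom D y y'. \<forall>h\<in>hom D (on_ob F x) y.
              \<Phi> x' y' (cmp D (on_ob F x') (on_ob F x) y'
                         (cmp D (on_ob F x) y y' g h) (on_hom F x' x f)) =
              cmp C x' x (on_ob G y')
                (cmp C x (on_ob G y) (on_ob G y') (on_hom G y y' g) (\<Phi> x y h)) f))"


section \<open>Globular sets\<close>

text \<open>
  Families of functions out of sets (here and below) are extensional, that is, undefined off
  their domain, so that HOL equality is equality of the families.
  \<open>gsrc X n\<close> and \<open>gtgt X n\<close> go from dimension \<open>Suc n\<close> to dimension \<open>n\<close>.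
\<close>

record 'x glob =
  gcells :: "nat \<Rightarrow> 'x set"
  gsrc :: "nat \<Rightarrow> 'x \<Rightarrow> 'x"
  gtgt :: "nat \<Rightarrow> 'x \<Rightarrow> 'x"

definition is_glob :: "'x glob \<Rightarrow> bool" where
  "is_glob X \<longleftrightarrow>
     (\<forall>n. gsrc X n \<in> gcells X (Suc n) \<rightarrow>\<^sub>E gcells X n) \<and>
     (\<forall>n. gtgt X n \<in> gcells X (Suc n) \<rightarrow>\<^sub>E gcells X n) \<and>
     (\<forall>n. \<forall>x\<in>gcells X (Suc (Suc n)).
        gsrc X n (gsrc X (Suc n) x) = gsrc X n (gtgt X (Suc n) x) \<and>
        gtgt X n (gsrc X (Suc n) x) = gtgt X n (gtgt X (Suc n) x))"

definition glob_hom :: "'x glob \<Rightarrow> 'y glob \<Rightarrow> (nat \<Rightarrow> 'x \<Rightarrow> 'y) set" where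
  "glob_hom X Y =
     {f. (\<forall>n. f n \<in> gcells X n \<rightarrow>\<^sub>E gcells Y n) \<and>
         (\<forall>n. \<forall>x\<in>gcells X (Suc n).
            f n (gsrc X n x) = gsrc Y n (f (Suc n) x) \<and>
            f n (gtgt X n x) = gtgt Y n (f (Suc n) x))}"

definition Glob :: "('x glob, nat \<Rightarrow> 'x \<Rightarrow> 'x) cat" where
  "Glob = \<lparr> ob = {X. is_glob X},
            hom = glob_hom,
            idn = (\<lambda>X n. \<lambda>x\<in>gcells X n. x),
            cmp = (\<lambda>X Y Z g f n. \<lambda>x\<in>gcells X n. g n (f n x)) \<rparr>"


section \<open>Batanin trees and their positions\<close>

datatype tree = Br "tree list"

fun tree_dim :: "tree \<Rightarrow> nat" where
  "tree_dim (Br Bs) = (if Bs = [] then 0 else 1 + Max (tree_dim ` set Bs))"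

text \<open>
  The dimension of a position is its number of \<open>PInl\<close>'s, so that the sets of positions of
  different dimensions are disjoint.
\<close>

datatype pos = PInit | PInl pos | PInr pos

inductive is_pos :: "tree \<Rightarrow> nat \<Rightarrow> pos \<Rightarrow> bool" where
  "is_pos B 0 PInit"
| "is_pos (Br Bs) n p \<Longrightarrow> is_pos (Br (B # Bs)) n (PInr p)"
| "is_pos B n q \<Longrightarrow> is_pos (Br (B # Bs)) (Suc n) (PInl q)"

text \<open>
  The index is the dimension of the resulting position: in \<open>pos_src n (PInl q)\<close>, the position
  \<open>q\<close> has dimension \<open>n\<close>.
\<close>

fun pos_src :: "nat \<Rightarrow> pos \<Rightarrow> pos" where
  "pos_src n (PInr p) = PInr (pos_src n p)"
| "pos_src 0 (PInl q) = PInit"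
| "pos_src (Suc n) (PInl q) = PInl (pos_src n q)"
| "pos_src n PInit = undefined"

fun pos_tgt :: "nat \<Rightarrow> pos \<Rightarrow> pos" where
  "pos_tgt n (PInr p) = PInr (pos_tgt n p)"
| "pos_tgt 0 (PInl q) = PInr PInit"
| "pos_tgt (Suc n) (PInl q) = PInl (pos_tgt n q)"
| "pos_tgt n PInit = undefined"

definition Pos :: "tree \<Rightarrow> pos glob" where
  "Pos B = \<lparr> gcells = (\<lambda>n. {p. is_pos B n p}),
             gsrc = (\<lambda>n. \<lambda>p\<in>{p. is_pos B (Suc n) p}. pos_src n p),
             gtgt = (\<lambda>n. \<lambda>p\<in>{p. is_pos B (Suc n) p}. pos_tgt n p) \<rparr>"

definition src_boundary :: "tree \<Rightarrow> nat \<Rightarrow> pos set" where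
  "src_boundary B n =
     {p \<in> gcells (Pos B) n. \<not> (\<exists>q\<in>gcells (Pos B) (Suc n). gtgt (Pos B) n q = p)}"

definition tgt_boundary :: "tree \<Rightarrow> nat \<Rightarrow> pos set" where
  "tgt_boundary B n =
     {p \<in> gcells (Pos B) n. \<not> (\<exists>q\<in>gcells (Pos B) (Suc n). gsrc (Pos B) n q = p)}"


section \<open>Raw cells, spheres and computads\<close>

text \<open>\<open>Pt\<close> is the unique sphere of dimension -1.\<close>

datatype 'c sphere = Pt | Sph "'c sphere" (pr1: 'c) (pr2: 'c)

text \<open>
  \<open>Var n v\<close> is the generator \<open>v\<close> of dimension \<open>n\<close>; the sets of generators of different
  dimensions need not be disjoint.  In particular, the elements \<open>v\<close> of a 0-computad are
  identified with its 0-cells \<open>Var 0 v\<close>.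
  In \<open>Coh B A \<tau>\<close>, the finite map \<open>\<tau>\<close> collects all the components of a homomorphism out of
  the free computad on \<open>B\<close>, which is possible since positions determine their dimension.
  The sphere \<open>A\<close> consists of cells whose generators are positions, whatever the type \<open>'v\<close> is:
  \<open>shape\<close> ties this knot.
\<close>

datatype ('s, 'v) pre_cell = Var nat 'v | Coh tree 's "(pos, ('s, 'v) pre_cell) fmap"

datatype shape = Shape (sphere_of: "(shape, pos) pre_cell sphere")

type_synonym 'v cell = "(shape, 'v) pre_cell"

text \<open>
  An object of the limit of the categories of \<open>n\<close>-computads is given by its sets of generators
  and attaching maps in all dimensions.  In dimension 0, the attaching map is constantly \<open>Pt\<close>.
\<close>

record 'v computad =
  gens :: "nat \<Rightarrow> 'v set"
  att :: "nat \<Rightarrow> 'v \<Rightarrow> 'v cell sphere"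

definition app :: "(pos, 'c) fmap \<Rightarrow> nat \<Rightarrow> pos \<Rightarrow> 'c" where
  "app \<tau> n p = the (fmlookup \<tau> p)"

primrec act :: "(nat \<Rightarrow> 'v \<Rightarrow> ('s, 'w) pre_cell) \<Rightarrow> ('s, 'v) pre_cell \<Rightarrow> ('s, 'w) pre_cell" where
  "act \<sigma> (Var n v) = \<sigma> n v"
| "act \<sigma> (Coh B A \<tau>) = Coh B A (fmmap (act \<sigma>) \<tau>)"

definition sphere_act :: "(nat \<Rightarrow> 'v \<Rightarrow> 'w cell) \<Rightarrow> 'v cell sphere \<Rightarrow> 'w cell sphere" where
  "sphere_act \<sigma> = map_sphere (act \<sigma>)"

fun bdry :: "'v computad \<Rightarrow> 'v cell \<Rightarrow> 'v cell sphere" where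
  "bdry C (Var n v) = att C n v"
| "bdry C (Coh B A \<tau>) = sphere_act (app \<tau>) (sphere_of A)"

text \<open>\<open>supp n\<close> is the support of cells of dimension \<open>n\<close>.\<close>

primrec supp :: "nat \<Rightarrow> ('s, 'v) pre_cell \<Rightarrow> 'v set" where
  "supp n (Var m v) = {v}"
| "supp n (Coh B A \<tau>) = (\<Union>p\<in>gcells (Pos B) n. app (fmmap (supp n) \<tau>) n p)"

primrec ps :: "'x glob \<Rightarrow> nat \<Rightarrow> 'x \<Rightarrow> 'x \<Rightarrow> 'x cell sphere" where
  "ps X 0 a b = Sph Pt (Var 0 a) (Var 0 b)"
| "ps X (Suc n) a b = Sph (ps X n (gsrc X n a) (gtgt X n a)) (Var (Suc n) a) (Var (Suc n) b)"

definition Free :: "'x glob \<Rightarrow> 'x computad" where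
  "Free X = \<lparr> gens = gcells X,
              att = (\<lambda>n. \<lambda>x\<in>gcells X n.
                       case n of 0 \<Rightarrow> Pt | Suc m \<Rightarrow> ps X m (gsrc X m x) (gtgt X m x)) \<rparr>"


section \<open>Well-formed cells, full spheres\<close>

text \<open>
  \<open>cell_in F C n c\<close>: \<open>c\<close> is an \<open>n\<close>-cell of \<open>C\<close>, given a predicate \<open>F n B A\<close> telling which are the
  full \<open>n\<close>-spheres \<open>A\<close> of the free computad on \<open>B\<close>.  It only depends on the part of \<open>C\<close> in
  dimensions at most \<open>n\<close>, and on \<open>F\<close> in dimensions below \<open>n\<close>.  The predicate is first a
  parameter, because it involves cells with positions as generators.
  The last two premises of the second rule say that \<open>\<tau>\<close> is a homomorphism from the free computad
  on \<open>B\<close> to \<open>C\<close>.  As \<open>tree_dim B \<le> Suc n\<close>, all its components are in dimensions at most \<open>Suc n\<close>.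
\<close>

inductive cell_in ::
  "(nat \<Rightarrow> tree \<Rightarrow> pos cell sphere \<Rightarrow> bool) \<Rightarrow> 'v computad \<Rightarrow> nat \<Rightarrow> 'v cell \<Rightarrow> bool"
  for F C where
  var: "v \<in> gens C n \<Longrightarrow> cell_in F C n (Var n v)"
| coh: "\<lbrakk> tree_dim B \<le> Suc n;
          F n B A;
          fmdom' \<tau> = (\<Union>k. gcells (Pos B) k);
          \<And>k p. p \<in> gcells (Pos B) k \<Longrightarrow>
            cell_in F C k (app \<tau> k p) \<and>
            bdry C (app \<tau> k p) = sphere_act (app \<tau>) (att (Free (Pos B)) k p) \<rbrakk>
        \<Longrightarrow> cell_in F C (Suc n) (Coh B (Shape A) \<tau>)"

lemma cell_in_mono [mono]:
  assumes "F \<le> G"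
  shows "cell_in F C n c \<longrightarrow> cell_in G C n c"
proof
  assume "cell_in F C n c"
  then show "cell_in G C n c"
  proof (induction rule: cell_in.induct)
    case (var v n)
    then show ?case by (rule cell_in.var)
  next
    case (coh B n A \<tau>)
    then show ?case using assms by (intro cell_in.coh) (auto simp: le_fun_def)
  qed
qed

inductive full :: "nat \<Rightarrow> tree \<Rightarrow> pos cell sphere \<Rightarrow> bool" where
  "\<lbrakk> a \<in> src_boundary B 0; b \<in> tgt_boundary B 0 \<rbrakk> \<Longrightarrow> full 0 B (Sph Pt (Var 0 a) (Var 0 b))"
| "\<lbrakk> full n B A;
     cell_in full (Free (Pos B)) (Suc n) a;
     cell_in full (Free (Pos B)) (Suc n) b;
     bdry (Free (Pos B)) a = A;
     bdry (Free (Pos B)) b = A;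
     supp (Suc n) a = src_boundary B (Suc n);
     supp (Suc n) b = tgt_boundary B (Suc n) \<rbrakk> \<Longrightarrow> full (Suc n) B (Sph A a b)"

definition cells :: "'v computad \<Rightarrow> nat \<Rightarrow> 'v cell set" where
  "cells C n = {c. cell_in full C n c}"

text \<open>\<open>bspheres C n\<close> is the set of spheres of dimension \<open>n - 1\<close>.\<close>

primrec bspheres :: "'v computad \<Rightarrow> nat \<Rightarrow> 'v cell sphere set" where
  "bspheres C 0 = {Pt}"
| "bspheres C (Suc n) =
     {Sph A a b | A a b. A \<in> bspheres C n \<and> a \<in> cells C n \<and> b \<in> cells C n \<and>
                         bdry C a = A \<and> bdry C b = A}"


section \<open>The category of computads\<close>

definition is_computad :: "'v computad \<Rightarrow> bool" where
  "is_computad C \<longleftrightarrow> (\<forall>n. att C n \<in> gens C n \<rightarrow>\<^sub>E bspheres C n)"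

definition comp_hom :: "'v computad \<Rightarrow> 'w computad \<Rightarrow> (nat \<Rightarrow> 'v \<Rightarrow> 'w cell) set" where
  "comp_hom D C =
     {\<sigma>. \<forall>n. \<sigma> n \<in> gens D n \<rightarrow>\<^sub>E cells C n \<and>
             (\<forall>v\<in>gens D n. bdry C (\<sigma> n v) = sphere_act \<sigma> (att D n v))}"

definition Comp :: "('v computad, nat \<Rightarrow> 'v \<Rightarrow> 'v cell) cat" where
  "Comp = \<lparr> ob = {C. is_computad C},
            hom = comp_hom,
            idn = (\<lambda>C n. \<lambda>v\<in>gens C n. Var n v),
            cmp = (\<lambda>E D C \<sigma> \<tau> n. \<lambda>v\<in>gens E n. act \<sigma> (\<tau> n v)) \<rparr>"


section \<open>The functors\<close>

definition Free_hom :: "'x glob \<Rightarrow> (nat \<Rightarrow> 'x \<Rightarrow> 'y) \<Rightarrow> nat \<Rightarrow> 'x \<Rightarrow> 'y cell" where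
  "Free_hom X f n = (\<lambda>x\<in>gcells X n. Var n (f n x))"

definition Free_functor ::
  "('u glob, nat \<Rightarrow> 'u \<Rightarrow> 'u, 'u computad, nat \<Rightarrow> 'u \<Rightarrow> 'u cell) func" where
  "Free_functor = \<lparr> on_ob = Free, on_hom = (\<lambda>X Y f. Free_hom X f) \<rparr>"

definition Cell :: "'v computad \<Rightarrow> 'v cell glob" where
  "Cell C = \<lparr> gcells = cells C,
              gsrc = (\<lambda>n. \<lambda>c\<in>cells C (Suc n). pr1 (bdry C c)),
              gtgt = (\<lambda>n. \<lambda>c\<in>cells C (Suc n). pr2 (bdry C c)) \<rparr>"

definition Cell_hom :: "'v computad \<Rightarrow> (nat \<Rightarrow> 'v \<Rightarrow> 'w cell) \<Rightarrow> nat \<Rightarrow> 'v cell \<Rightarrow> 'w cell" where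
  "Cell_hom D \<sigma> n = (\<lambda>c\<in>cells D n. act \<sigma> c)"

text \<open>
  The cells of a computad over the type \<open>'u\<close> form a globular set over \<open>'u cell\<close>.  To have one
  category of globular sets and one of computads, both over a fixed type \<open>'u\<close> playing the role of
  the universe of small sets, globular sets over \<open>'u cell\<close> are renamed along an injection
  \<open>enc\<close> of \<open>'u cell\<close> into \<open>'u\<close>, under which the universe is thus assumed to be closed.
\<close>

definition rename :: "('x \<Rightarrow> 'y) \<Rightarrow> 'x glob \<Rightarrow> 'y glob" where
  "rename enc X =
     \<lparr> gcells = (\<lambda>n. enc ` gcells X n),
       gsrc = (\<lambda>n. \<lambda>y\<in>enc ` gcells X (Suc n). enc (gsrc X n (inv enc y))),
       gtgt = (\<lambda>n. \<lambda>y\<in>enc ` gcells X (Suc n). enc (gtgt X n (inv enc y))) \<rparr>"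

definition rename_hom ::
  "('x \<Rightarrow> 'y) \<Rightarrow> 'x glob \<Rightarrow> (nat \<Rightarrow> 'x \<Rightarrow> 'x) \<Rightarrow> nat \<Rightarrow> 'y \<Rightarrow> 'y" where
  "rename_hom enc X f n = (\<lambda>y\<in>enc ` gcells X n. enc (f n (inv enc y)))"

definition Cell_functor ::
  "('u cell \<Rightarrow> 'u) \<Rightarrow> ('u computad, nat \<Rightarrow> 'u \<Rightarrow> 'u cell, 'u glob, nat \<Rightarrow> 'u \<Rightarrow> 'u) func" where
  "Cell_functor enc =
     \<lparr> on_ob = (\<lambda>C. rename enc (Cell C)),
       on_hom = (\<lambda>D C \<sigma>. rename_hom enc (Cell D) (Cell_hom D \<sigma>)) \<rparr>"

text \<open>
  Types with such an injection exist: every type \<open>'a\<close> embeds into one, by \<open>Atom\<close>.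
\<close>

datatype 'a univ = Atom 'a | Code "(shape, 'a univ) pre_cell"

lemma universe_exists: "inj (Code :: 'a univ cell \<Rightarrow> 'a univ)"
  by (simp add: inj_def)

end

theory Submission
  imports Defs
begin

text \<open>
  A homomorphism \<open>h\<close> from \<open>Free X\<close> to a computad \<open>C\<close> assigns to every \<open>x\<close> of dimension \<open>n\<close> an
  \<open>n\<close>-cell of \<open>C\<close>, subject to one equation per \<open>x\<close>, which prescribes the whole boundary sphere of
  \<open>h x\<close>.  A morphism of globular sets from \<open>X\<close> to \<open>Cell C\<close> is the same kind of assignment, but its
  equations prescribe only the two top components of that sphere, the source and the target of
  \<open>h x\<close>.  The adjunction says that these two systems of equations are equivalent, so that the
  adjunct of \<open>h\<close> is \<open>h\<close> itself, up to the encoding of cells.  The reason is that the top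
  components determine the sphere: it has the form \<open>Sph A a b\<close> with \<open>A\<close> the boundary of \<open>a\<close>, so an
  induction on the dimension recovers everything below (\<open>bdry_of_glob_hom\<close>).

  This uses that the boundary of a cell is a sphere of the computad
  (\<open>bdry_in_bspheres\<close>), which is also what makes \<open>Cell C\<close> globular.  For a coherence cell
  \<open>Coh B A \<tau>\<close> the boundary is the image under \<open>\<tau>\<close> of a sphere of the free computad on \<open>B\<close>, so one
  needs to know that homomorphisms send cells to cells and commute with boundaries
  (\<open>act_cell_bdry\<close>).  That in turn is an induction on cells, resting on \<open>act_act\<close>, which makes
  composition associative, and on \<open>act_cong\<close>, by which the action on a cell of \<open>C\<close> sees only the
  values at the generators of \<open>C\<close>.  The latter is needed at every composition, because a composite
  is the pointwise composite at the generators only, be it a family cut off to be extensional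
  or the finite map of a coherence cell.
\<close>

section \<open>Globularity of positions and free computads\<close>

lemma is_globI:
  assumes "\<And>n x. x \<in> gcells X (Suc n) \<Longrightarrow> gsrc X n x \<in> gcells X n"
    and "\<And>n x. x \<in> gcells X (Suc n) \<Longrightarrow> gtgt X n x \<in> gcells X n"
    and "\<And>n x. x \<notin> gcells X (Suc n) \<Longrightarrow> gsrc X n x = undefined"
    and "\<And>n x. x \<notin> gcells X (Suc n) \<Longrightarrow> gtgt X n x = undefined"
    and "\<And>n x. x \<in> gcells X (Suc (Suc n)) \<Longrightarrow>
      gsrc X n (gsrc X (Suc n) x) = gsrc X n (gtgt X (Suc n) x)"
    and "\<And>n x. x \<in> gcells X (Suc (Suc n)) \<Longrightarrow>
      gtgt X n (gsrc X (Suc n) x) = gtgt X n (gtgt X (Suc n) x)"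
  shows "is_glob X"
  unfolding is_glob_def PiE_iff extensional_def using assms by blast

lemma is_globD:
  assumes "is_glob X"
  shows glob_src: "x \<in> gcells X (Suc n) \<Longrightarrow> gsrc X n x \<in> gcells X n"
    and glob_tgt: "x \<in> gcells X (Suc n) \<Longrightarrow> gtgt X n x \<in> gcells X n"
    and glob_src_src: "x \<in> gcells X (Suc (Suc n)) \<Longrightarrow>
      gsrc X n (gsrc X (Suc n) x) = gsrc X n (gtgt X (Suc n) x)"
    and glob_tgt_tgt: "x \<in> gcells X (Suc (Suc n)) \<Longrightarrow>
      gtgt X n (gsrc X (Suc n) x) = gtgt X n (gtgt X (Suc n) x)"
  using assms unfolding is_glob_def by blast+

lemma is_pos_src: "is_pos B (Suc n) p \<Longrightarrow> is_pos B n (pos_src n p)"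
proof (induction B "Suc n" p arbitrary: n rule: is_pos.induct)
  case (3 B n q Bs)
  then show ?case by (cases n) (auto intro: is_pos.intros)
qed (auto intro: is_pos.intros)

lemma is_pos_tgt: "is_pos B (Suc n) p \<Longrightarrow> is_pos B n (pos_tgt n p)"
proof (induction B "Suc n" p arbitrary: n rule: is_pos.induct)
  case (3 B n q Bs)
  then show ?case by (cases n) (auto intro: is_pos.intros)
qed (auto intro: is_pos.intros)

lemma pos_globular:
  "is_pos B (Suc (Suc n)) p \<Longrightarrow>
     pos_src n (pos_src (Suc n) p) = pos_src n (pos_tgt (Suc n) p) \<and>
     pos_tgt n (pos_src (Suc n) p) = pos_tgt n (pos_tgt (Suc n) p)"
proof (induction B "Suc (Suc n)" p arbitrary: n rule: is_pos.induct)
  case (3 B q Bs)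
  then show ?case by (cases n) auto
qed auto

lemma is_glob_Pos: "is_glob (Pos B)"
  by (rule is_globI) (auto simp: Pos_def is_pos_src is_pos_tgt pos_globular)

lemma gens_Free [simp]: "gens (Free X) = gcells X"
  by (simp add: Free_def)

lemma att_Free_0 [simp]: "x \<in> gcells X 0 \<Longrightarrow> att (Free X) 0 x = Pt"
  by (simp add: Free_def)

lemma cells_var: "v \<in> gens C n \<Longrightarrow> Var n v \<in> cells C n"
  by (simp add: cells_def cell_in.var)

lemma ps_eq: "a \<in> gcells X n \<Longrightarrow> ps X n a b = Sph (att (Free X) n a) (Var n a) (Var n b)"
  by (cases n) (simp_all add: Free_def)

text \<open>
  The recursion on the dimension hidden in \<open>ps\<close>: the attaching sphere of \<open>x\<close> is built on that of
  the source of \<open>x\<close>.  All later inductions on the dimension of a generator use this form.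
\<close>

lemma att_Free_Suc:
  assumes "is_glob X" "x \<in> gcells X (Suc n)"
  shows "att (Free X) (Suc n) x =
    Sph (att (Free X) n (gsrc X n x)) (Var n (gsrc X n x)) (Var n (gtgt X n x))"
proof -
  have "att (Free X) (Suc n) x = ps X n (gsrc X n x) (gtgt X n x)"
    using assms(2) by (simp add: Free_def)
  then show ?thesis
    by (simp add: ps_eq glob_src[OF assms])
qed

lemma att_Free_parallel:
  assumes "is_glob X" "x \<in> gcells X (Suc n)"
  shows "att (Free X) n (gsrc X n x) = att (Free X) n (gtgt X n x)"
proof (cases n)
  case 0
  then show ?thesis using glob_src[OF assms] glob_tgt[OF assms] by simp
next
  case (Suc m)
  then show ?thesis
    using assms glob_src[OF assms] glob_tgt[OF assms]
    by (simp add: att_Free_Suc[OF assms(1)] glob_src_src glob_tgt_tgt)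
qed

lemma att_Free_in_bspheres:
  assumes "is_glob X"
  shows "x \<in> gcells X n \<Longrightarrow> att (Free X) n x \<in> bspheres (Free X) n"
proof (induction n arbitrary: x)
  case 0
  then show ?case by simp
next
  case (Suc n)
  note x = \<open>x \<in> gcells X (Suc n)\<close>
  show ?case
    using Suc.IH[OF glob_src[OF assms x]] glob_src[OF assms x] glob_tgt[OF assms x]
    by (simp add: att_Free_Suc[OF assms x] cells_var att_Free_parallel[OF assms x])
qed

lemma is_computad_Free:
  assumes "is_glob X"
  shows "is_computad (Free X)"
  unfolding is_computad_def
proof (intro allI PiE_I)
  fix n x
  show "x \<in> gens (Free X) n \<Longrightarrow> att (Free X) n x \<in> bspheres (Free X) n"
    by (simp add: att_Free_in_bspheres[OF assms])
  show "x \<notin> gens (Free X) n \<Longrightarrow> att (Free X) n x = undefined"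
    by (simp add: Free_def)
qed

text \<open>
  By induction on the dimension, because the rule induction for \<open>full\<close>, a predicate passed as a
  parameter to \<open>cell_in\<close>, speaks of cells for a stronger predicate in place of \<open>full\<close>.
\<close>

lemma full_in_bspheres: "full n B A \<Longrightarrow> A \<in> bspheres (Free (Pos B)) (Suc n)"
proof (induction n arbitrary: A)
  case 0
  then show ?case
    by cases (auto simp: cells_var src_boundary_def tgt_boundary_def)
next
  case (Suc n)
  from Suc.prems show ?case
  proof cases
    case (2 A' a b)
    then show ?thesis using Suc.IH[OF 2(2)] unfolding bspheres.simps(2)[of _ "Suc n"]
      by (simp add: cells_def del: bspheres.simps)
  qed
qed


section \<open>The action of homomorphisms on cells and spheres\<close>

lemma act_act: "act \<sigma> (act \<tau> c) = act (\<lambda>n v. act \<sigma> (\<tau> n v)) c"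
proof (induction c)
  case (Coh B A \<rho>)
  have "fmmap (act \<sigma>) (fmmap (act \<tau>) \<rho>) = fmmap (act (\<lambda>n v. act \<sigma> (\<tau> n v))) \<rho>"
  proof (rule fmap_ext)
    fix p
    show "fmlookup (fmmap (act \<sigma>) (fmmap (act \<tau>) \<rho>)) p =
        fmlookup (fmmap (act (\<lambda>n v. act \<sigma> (\<tau> n v))) \<rho>) p"
      by (cases "fmlookup \<rho> p") (auto dest: fmran'I Coh)
  qed
  then show ?case by simp
qed simp

lemma act_Var: "act Var c = c"
proof (induction c)
  case (Coh B A \<rho>)
  have "fmmap (act Var) \<rho> = \<rho>"
  proof (rule fmap_ext)
    fix p
    show "fmlookup (fmmap (act Var) \<rho>) p = fmlookup \<rho> p"
      by (cases "fmlookup \<rho> p") (auto dest: fmran'I Coh)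
  qed
  then show ?case by simp
qed simp

lemma act_cong:
  assumes "\<And>m v. v \<in> gens C m \<Longrightarrow> \<sigma> m v = \<sigma>' m v"
  shows "c \<in> cells C n \<Longrightarrow> act \<sigma> c = act \<sigma>' c"
  unfolding cells_def mem_Collect_eq
proof (induction rule: cell_in.induct)
  case (var v n)
  then show ?case by (simp add: assms)
next
  case (coh B n A \<tau>)
  have "fmmap (act \<sigma>) \<tau> = fmmap (act \<sigma>') \<tau>"
  proof (rule fmap_ext)
    fix p
    show "fmlookup (fmmap (act \<sigma>) \<tau>) p = fmlookup (fmmap (act \<sigma>') \<tau>) p"
    proof (cases "fmlookup \<tau> p")
      case (Some c)
      then have "p \<in> fmdom' \<tau>" by (rule fmdom'I)
      then obtain k where "p \<in> gcells (Pos B) k" using coh(3) by blast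
      from coh(4)[OF this] Some show ?thesis by (simp add: app_def)
    qed simp
  qed
  then show ?case by simp
qed

lemma sphere_act_simps [simp]:
  "sphere_act \<sigma> Pt = Pt"
  "sphere_act \<sigma> (Sph A a b) = Sph (sphere_act \<sigma> A) (act \<sigma> a) (act \<sigma> b)"
  by (simp_all add: sphere_act_def)

lemma sphere_act_act: "sphere_act \<sigma> (sphere_act \<tau> A) = sphere_act (\<lambda>n v. act \<sigma> (\<tau> n v)) A"
  by (induction A) (simp_all add: act_act)

lemma sphere_act_Var: "sphere_act Var A = A"
  by (induction A) (simp_all add: act_Var)

lemma sphere_act_cong:
  assumes "\<And>m v. v \<in> gens C m \<Longrightarrow> \<sigma> m v = \<sigma>' m v"
  shows "A \<in> bspheres C n \<Longrightarrow> sphere_act \<sigma> A = sphere_act \<sigma>' A"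
  by (induction n arbitrary: A) (auto intro: act_cong[OF assms])

text \<open>
  The conditions of a homomorphism on generators alone, without extensionality, so that they apply
  to the map \<open>app \<tau>\<close> of a coherence cell.
\<close>

definition hom_on_gens :: "'v computad \<Rightarrow> 'w computad \<Rightarrow> (nat \<Rightarrow> 'v \<Rightarrow> 'w cell) \<Rightarrow> bool" where
  "hom_on_gens D C \<sigma> \<longleftrightarrow>
     (\<forall>n. \<forall>v\<in>gens D n. \<sigma> n v \<in> cells C n \<and> bdry C (\<sigma> n v) = sphere_act \<sigma> (att D n v))"

lemma comp_hom_iff:
  "\<sigma> \<in> comp_hom D C \<longleftrightarrow>
     hom_on_gens D C \<sigma> \<and> (\<forall>n v. v \<notin> gens D n \<longrightarrow> \<sigma> n v = undefined)"
  unfolding comp_hom_def hom_on_gens_def by (auto simp: PiE_iff extensional_def)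

lemma cell_in_full_cases:
  assumes "c \<in> cells C n"
  obtains (var) v where "c = Var n v" "v \<in> gens C n"
  | (coh) m B A \<tau> where "n = Suc m" "c = Coh B (Shape A) \<tau>" "full m B A"
      "hom_on_gens (Free (Pos B)) C (app \<tau>)"
proof -
  have "cell_in full C n c" using assms by (simp add: cells_def)
  then show thesis
  proof cases
    case (var v)
    then show thesis using that(1) by blast
  next
    case (coh B m A \<tau>)
    then have "hom_on_gens (Free (Pos B)) C (app \<tau>)"
      by (simp add: hom_on_gens_def cells_def)
    with coh show thesis using that(2) by blast
  qed
qed

text \<open>
  Boundary and action commute on a coherence cell because both sides are the image of the same
  full sphere under the composite of \<open>\<sigma>\<close> and \<open>\<tau>\<close>.  The finite map \<open>fmmap (act \<sigma>) \<tau>\<close> agrees with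
  this composite only at positions of \<open>B\<close>; this suffices, since the spheres involved are
  spheres of the free computad on \<open>B\<close>.
\<close>

lemma act_cell_bdry:
  assumes \<sigma>: "hom_on_gens D C \<sigma>"
  shows "c \<in> cells D n \<Longrightarrow> act \<sigma> c \<in> cells C n \<and> bdry C (act \<sigma> c) = sphere_act \<sigma> (bdry D c)"
  unfolding cells_def mem_Collect_eq
proof (induction rule: cell_in.induct)
  case (var v n)
  then show ?case using \<sigma> by (simp add: hom_on_gens_def cells_def)
next
  case (coh B n A \<tau>)
  let ?\<sigma>\<tau> = "fmmap (act \<sigma>) \<tau>"
  have app: "app ?\<sigma>\<tau> k p = act \<sigma> (app \<tau> k p)" if "p \<in> gcells (Pos B) k" for k p
  proof -
    have "p \<in> fmdom' \<tau>" using that coh(3) by blast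
    then show ?thesis by (auto simp: app_def fmlookup_dom'_iff)
  qed
  have comp: "sphere_act (app ?\<sigma>\<tau>) S = sphere_act \<sigma> (sphere_act (app \<tau>) S)"
    if "S \<in> bspheres (Free (Pos B)) k" for S k
    unfolding sphere_act_act by (rule sphere_act_cong[OF _ that]) (simp add: app)
  have "cell_in full C (Suc n) (Coh B (Shape A) ?\<sigma>\<tau>)"
  proof (rule cell_in.coh)
    show "fmdom' ?\<sigma>\<tau> = (\<Union>k. gcells (Pos B) k)" using coh(3) by simp
    fix k p
    assume p: "p \<in> gcells (Pos B) k"
    have "bdry C (act \<sigma> (app \<tau> k p)) = sphere_act \<sigma> (sphere_act (app \<tau>) (att (Free (Pos B)) k p))"
      using coh(4)[OF p] by simp
    then show "cell_in full C k (app ?\<sigma>\<tau> k p) \<and>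
        bdry C (app ?\<sigma>\<tau> k p) = sphere_act (app ?\<sigma>\<tau>) (att (Free (Pos B)) k p)"
      using coh(4)[OF p] by (simp add: app[OF p] comp[OF att_Free_in_bspheres[OF is_glob_Pos p]])
  qed (fact coh)+
  moreover have "bdry C (Coh B (Shape A) ?\<sigma>\<tau>) = sphere_act \<sigma> (bdry D (Coh B (Shape A) \<tau>))"
    by (simp add: comp[OF full_in_bspheres[OF coh(2)]])
  ultimately show ?case by simp
qed

lemma act_in_cells: "hom_on_gens D C \<sigma> \<Longrightarrow> c \<in> cells D n \<Longrightarrow> act \<sigma> c \<in> cells C n"
  and bdry_act: "hom_on_gens D C \<sigma> \<Longrightarrow> c \<in> cells D n \<Longrightarrow> bdry C (act \<sigma> c) = sphere_act \<sigma> (bdry D c)"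
  using act_cell_bdry by blast+

lemma sphere_act_in_bspheres:
  assumes "hom_on_gens D C \<sigma>"
  shows "A \<in> bspheres D n \<Longrightarrow> sphere_act \<sigma> A \<in> bspheres C n"
  by (induction n arbitrary: A) (auto simp: act_in_cells[OF assms] bdry_act[OF assms])

lemma bdry_in_bspheres:
  assumes "is_computad C" "c \<in> cells C n"
  shows "bdry C c \<in> bspheres C n"
  using assms(2)
proof (cases rule: cell_in_full_cases)
  case (var v)
  then show ?thesis using assms(1) by (auto simp: is_computad_def)
next
  case (coh m B A \<tau>)
  from sphere_act_in_bspheres[OF coh(4) full_in_bspheres[OF coh(3)]] coh show ?thesis
    by simp
qed

lemma bdry_Suc:
  assumes "is_computad C" "c \<in> cells C (Suc n)"
  obtains a b where "bdry C c = Sph (bdry C a) a b" "a \<in> cells C n" "b \<in> cells C n"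
    "bdry C b = bdry C a"
  using bdry_in_bspheres[OF assms] by auto


section \<open>The two categories\<close>

lemma hom_on_gens_cong:
  assumes "is_computad D" and eq: "\<And>n v. v \<in> gens D n \<Longrightarrow> \<sigma> n v = \<sigma>' n v"
  shows "hom_on_gens D C \<sigma> \<longleftrightarrow> hom_on_gens D C \<sigma>'"
proof -
  have "sphere_act \<sigma> (att D n v) = sphere_act \<sigma>' (att D n v)" if "v \<in> gens D n" for n v
    by (rule sphere_act_cong[OF eq, where n = n]) (use assms(1) that in \<open>auto simp: is_computad_def\<close>)
  then show ?thesis by (simp add: hom_on_gens_def eq)
qed

lemma hom_on_gens_Var: "hom_on_gens C C Var"
  by (simp add: hom_on_gens_def cells_var sphere_act_Var)

lemma hom_on_gens_comp:
  assumes "hom_on_gens E D \<tau>" "hom_on_gens D C \<sigma>"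
  shows "hom_on_gens E C (\<lambda>n v. act \<sigma> (\<tau> n v))"
  unfolding hom_on_gens_def
proof (intro allI ballI)
  fix n v
  assume "v \<in> gens E n"
  with assms(1) have "\<tau> n v \<in> cells D n" "bdry D (\<tau> n v) = sphere_act \<tau> (att E n v)"
    by (simp_all add: hom_on_gens_def)
  then show "act \<sigma> (\<tau> n v) \<in> cells C n \<and>
      bdry C (act \<sigma> (\<tau> n v)) = sphere_act (\<lambda>n v. act \<sigma> (\<tau> n v)) (att E n v)"
    by (simp add: act_in_cells[OF assms(2)] bdry_act[OF assms(2)] sphere_act_act)
qed

lemma restrict_in_comp_hom:
  assumes "is_computad D" "hom_on_gens D C \<sigma>"
  shows "(\<lambda>n. \<lambda>v\<in>gens D n. \<sigma> n v) \<in> comp_hom D C"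
  using assms(2) hom_on_gens_cong[OF assms(1), of "\<lambda>n. \<lambda>v\<in>gens D n. \<sigma> n v" \<sigma>]
  by (simp add: comp_hom_iff)

lemma act_restrict:
  assumes "c \<in> cells D n"
  shows "act (\<lambda>n. \<lambda>v\<in>gens D n. \<sigma> n v) c = act \<sigma> c"
  by (rule act_cong[OF _ assms]) simp

lemma comp_hom_cells: "\<sigma> \<in> comp_hom D C \<Longrightarrow> v \<in> gens D n \<Longrightarrow> \<sigma> n v \<in> cells C n"
  by (auto simp: comp_hom_iff hom_on_gens_def)

lemma comp_hom_ext:
  assumes "\<sigma> \<in> comp_hom D C"
  shows "(\<lambda>n. \<lambda>v\<in>gens D n. \<sigma> n v) = \<sigma>"
  using assms by (auto simp: comp_hom_iff fun_eq_iff restrict_def)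

lemma is_category_Comp: "is_category Comp"
proof -
  have "(\<lambda>n. \<lambda>v\<in>gens C n. Var n v) \<in> comp_hom C C" if "is_computad C" for C :: "'v computad"
    using restrict_in_comp_hom[OF that hom_on_gens_Var] .
  moreover have "(\<lambda>n. \<lambda>v\<in>gens E n. act \<sigma> (\<tau> n v)) \<in> comp_hom E C"
    if "is_computad E" "\<tau> \<in> comp_hom E D" "\<sigma> \<in> comp_hom D C"
    for E D C :: "'v computad" and \<sigma> \<tau>
    using that by (intro restrict_in_comp_hom hom_on_gens_comp) (auto simp: comp_hom_iff)
  moreover have "(\<lambda>n. \<lambda>v\<in>gens D n. act \<sigma> ((\<lambda>v\<in>gens D n. Var n v) v)) = \<sigma>"
    if "\<sigma> \<in> comp_hom D C" for D C :: "'v computad" and \<sigma>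
    by (subst (2) comp_hom_ext[OF that, symmetric]) (simp cong: restrict_cong)
  moreover have "(\<lambda>n. \<lambda>v\<in>gens D n. act (\<lambda>n. \<lambda>v\<in>gens C n. Var n v) (\<sigma> n v)) = \<sigma>"
    if "\<sigma> \<in> comp_hom D C" for D C :: "'v computad" and \<sigma>
    by (subst (2) comp_hom_ext[OF that, symmetric])
      (simp add: act_restrict[OF comp_hom_cells[OF that]] act_Var cong: restrict_cong)
  moreover have "(\<lambda>n. \<lambda>v\<in>gens E n. act (\<lambda>n. \<lambda>v\<in>gens D n. act \<rho> (\<sigma> n v)) (\<tau> n v)) =
      (\<lambda>n. \<lambda>v\<in>gens E n. act \<rho> ((\<lambda>v\<in>gens E n. act \<sigma> (\<tau> n v)) v))"
    if "\<tau> \<in> comp_hom E D" for E D :: "'v computad" and \<rho> \<sigma> \<tau>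
    by (simp add: act_restrict[OF comp_hom_cells[OF that]] act_act cong: restrict_cong)
  ultimately show ?thesis
    unfolding is_category_def Comp_def by auto
qed

lemma glob_hom_iff:
  "f \<in> glob_hom X Y \<longleftrightarrow>
     (\<forall>n. \<forall>x\<in>gcells X n. f n x \<in> gcells Y n) \<and> (\<forall>n x. x \<notin> gcells X n \<longrightarrow> f n x = undefined) \<and>
     (\<forall>n. \<forall>x\<in>gcells X (Suc n). f n (gsrc X n x) = gsrc Y n (f (Suc n) x) \<and>
        f n (gtgt X n x) = gtgt Y n (f (Suc n) x))"
  unfolding glob_hom_def by (auto simp: PiE_iff extensional_def)

lemma is_category_Glob: "is_category Glob"
  unfolding is_category_def Glob_def
  by (auto simp: glob_hom_iff fun_eq_iff restrict_def glob_src glob_tgt)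


section \<open>The two functors\<close>

lemma Free_hom_hom_on_gens:
  assumes X: "is_glob X" and Y: "is_glob Y" and f: "f \<in> glob_hom X Y"
  shows "hom_on_gens (Free X) (Free Y) (\<lambda>n x. Var n (f n x))"
proof -
  have f_cell: "f n x \<in> gcells Y n" if "x \<in> gcells X n" for n x
    using f that by (simp add: glob_hom_iff)
  have "att (Free Y) n (f n x) = sphere_act (\<lambda>n x. Var n (f n x)) (att (Free X) n x)"
    if "x \<in> gcells X n" for n x
    using that
  proof (induction n arbitrary: x)
    case 0
    then show ?case by (simp add: f_cell)
  next
    case (Suc n)
    then show ?case
      using f glob_src[OF X Suc.prems]
      by (simp add: att_Free_Suc[OF X] att_Free_Suc[OF Y] f_cell Suc.IH[symmetric] glob_hom_iff)
  qed
  then show ?thesis by (simp add: hom_on_gens_def cells_var f_cell)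
qed

lemma is_functor_Free: "is_functor Glob Comp Free_functor"
proof -
  have hom: "Free_hom X f \<in> comp_hom (Free X) (Free Y)"
    if "is_glob X" "is_glob Y" "f \<in> glob_hom X Y" for X Y :: "'u glob" and f
    using restrict_in_comp_hom[OF is_computad_Free[OF that(1)] Free_hom_hom_on_gens[OF that]]
    by (simp add: Free_hom_def[abs_def])
  show ?thesis
    unfolding is_functor_def
    using is_category_Glob is_category_Comp
    by (auto simp: Free_functor_def Glob_def Comp_def is_computad_Free hom Free_hom_def
        glob_hom_iff fun_eq_iff restrict_def)
qed

lemma Cell_src:
  assumes "c \<in> cells C (Suc n)"
  shows "gsrc (Cell C) n c = pr1 (bdry C c)" "gtgt (Cell C) n c = pr2 (bdry C c)"
  using assms by (simp_all add: Cell_def)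

lemma gcells_Cell [simp]: "gcells (Cell C) = cells C"
  by (simp add: Cell_def)

text \<open>
  The source and the target of an \<open>n+2\<close>-cell have a common boundary, hence the globular
  identities.
\<close>

lemma is_glob_Cell:
  assumes "is_computad C"
  shows "is_glob (Cell C)"
proof (rule is_globI)
  fix n c
  assume "c \<in> gcells (Cell C) (Suc n)"
  then have c: "c \<in> cells C (Suc n)" by simp
  from bdry_Suc[OF assms this] obtain a b
    where ab: "bdry C c = Sph (bdry C a) a b" "a \<in> cells C n" "b \<in> cells C n" .
  show "gsrc (Cell C) n c \<in> gcells (Cell C) n" "gtgt (Cell C) n c \<in> gcells (Cell C) n"
    by (simp_all add: Cell_src[OF c] ab)
next
  fix n c
  assume "c \<in> gcells (Cell C) (Suc (Suc n))"
  then have c: "c \<in> cells C (Suc (Suc n))" by simp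
  from bdry_Suc[OF assms this] obtain a b
    where ab: "bdry C c = Sph (bdry C a) a b" "a \<in> cells C (Suc n)" "b \<in> cells C (Suc n)"
      "bdry C b = bdry C a" .
  show "gsrc (Cell C) n (gsrc (Cell C) (Suc n) c) = gsrc (Cell C) n (gtgt (Cell C) (Suc n) c)"
    "gtgt (Cell C) n (gsrc (Cell C) (Suc n) c) = gtgt (Cell C) n (gtgt (Cell C) (Suc n) c)"
    using ab by (simp_all add: Cell_src c)
qed (simp_all add: Cell_def)

lemma Cell_hom_in_glob_hom:
  assumes "is_computad D" "\<sigma> \<in> comp_hom D C"
  shows "Cell_hom D \<sigma> \<in> glob_hom (Cell D) (Cell C)"
proof -
  have \<sigma>: "hom_on_gens D C \<sigma>" using assms(2) by (simp add: comp_hom_iff)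
  have "Cell_hom D \<sigma> n (gsrc (Cell D) n c) = gsrc (Cell C) n (Cell_hom D \<sigma> (Suc n) c) \<and>
      Cell_hom D \<sigma> n (gtgt (Cell D) n c) = gtgt (Cell C) n (Cell_hom D \<sigma> (Suc n) c)"
    if c: "c \<in> cells D (Suc n)" for n c
  proof -
    from bdry_Suc[OF assms(1) c] obtain a b
      where ab: "bdry D c = Sph (bdry D a) a b" "a \<in> cells D n" "b \<in> cells D n" .
    then show ?thesis
      by (simp add: Cell_src c act_in_cells[OF \<sigma>] bdry_act[OF \<sigma> c] Cell_hom_def)
  qed
  then show ?thesis by (simp add: glob_hom_iff Cell_hom_def act_in_cells[OF \<sigma>])
qed

lemma gcells_rename [simp]: "gcells (rename enc X) n = enc ` gcells X n"
  by (simp add: rename_def)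

lemma rename_src:
  assumes "inj enc" "x \<in> gcells X (Suc n)"
  shows "gsrc (rename enc X) n (enc x) = enc (gsrc X n x)"
    "gtgt (rename enc X) n (enc x) = enc (gtgt X n x)"
  using assms by (simp_all add: rename_def)

lemma is_glob_rename:
  assumes enc: "inj enc" and X: "is_glob X"
  shows "is_glob (rename enc X)"
proof (rule is_globI)
  fix n y
  assume "y \<in> gcells (rename enc X) (Suc n)"
  then show "gsrc (rename enc X) n y \<in> gcells (rename enc X) n"
    "gtgt (rename enc X) n y \<in> gcells (rename enc X) n"
    by (auto simp: rename_src[OF enc] glob_src[OF X] glob_tgt[OF X])
next
  fix n y
  assume "y \<in> gcells (rename enc X) (Suc (Suc n))"
  then show "gsrc (rename enc X) n (gsrc (rename enc X) (Suc n) y) =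
      gsrc (rename enc X) n (gtgt (rename enc X) (Suc n) y)"
    "gtgt (rename enc X) n (gsrc (rename enc X) (Suc n) y) =
      gtgt (rename enc X) n (gtgt (rename enc X) (Suc n) y)"
    by (auto simp: rename_src[OF enc] glob_src[OF X] glob_tgt[OF X] glob_src_src[OF X]
        glob_tgt_tgt[OF X])
qed (simp_all add: rename_def)

lemma rename_hom_enc [simp]:
  assumes "inj enc" "x \<in> gcells X n"
  shows "rename_hom enc X f n (enc x) = enc (f n x)"
  using assms by (simp add: rename_hom_def)

lemma rename_hom_in_glob_hom:
  assumes enc: "inj enc" and X: "is_glob X" and f: "f \<in> glob_hom X Y"
  shows "rename_hom enc X f \<in> glob_hom (rename enc X) (rename enc Y)"
  using f unfolding glob_hom_iff
  by (auto simp: rename_src[OF enc] glob_src[OF X] glob_tgt[OF X] enc)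
    (auto simp: rename_hom_def)

lemma is_functor_Cell:
  fixes enc :: "'u cell \<Rightarrow> 'u"
  assumes enc: "inj enc"
  shows "is_functor Comp Glob (Cell_functor enc)"
proof -
  have "is_glob (rename enc (Cell C))" if "is_computad C" for C
    using is_glob_rename[OF enc is_glob_Cell[OF that]] .
  moreover have "rename_hom enc (Cell D) (Cell_hom D \<sigma>) \<in>
      glob_hom (rename enc (Cell D)) (rename enc (Cell C))"
    if "is_computad D" "\<sigma> \<in> comp_hom D C" for D C \<sigma>
    using rename_hom_in_glob_hom[OF enc is_glob_Cell[OF that(1)] Cell_hom_in_glob_hom[OF that]] .
  moreover have "rename_hom enc (Cell C) (Cell_hom C (\<lambda>n. \<lambda>v\<in>gens C n. Var n v)) n =
      (\<lambda>y\<in>enc ` cells C n. y)" for C n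
    by (auto simp: rename_hom_def fun_eq_iff restrict_def[of _ "enc ` _"] Cell_hom_def enc
        act_restrict act_Var)
  moreover have "rename_hom enc (Cell E) (Cell_hom E (\<lambda>n. \<lambda>v\<in>gens E n. act \<sigma> (\<tau> n v))) n =
      (\<lambda>y\<in>enc ` cells E n. rename_hom enc (Cell D) (Cell_hom D \<sigma>) n
         (rename_hom enc (Cell E) (Cell_hom E \<tau>) n y))"
    if "\<tau> \<in> comp_hom E D" for E D \<sigma> \<tau> n
  proof -
    have "hom_on_gens E D \<tau>" using that by (simp add: comp_hom_iff)
    note act_in_cells[OF this]
    then show ?thesis
      by (auto simp: rename_hom_def fun_eq_iff restrict_def[of _ "enc ` _"] Cell_hom_def enc
          act_restrict act_act)
  qed
  ultimately show ?thesis
    unfolding is_functor_def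
    using is_category_Glob is_category_Comp
    by (simp add: Cell_functor_def Glob_def Comp_def fun_eq_iff)
qed


section \<open>The adjunction\<close>

text \<open>
  Let \<open>Sph A a b\<close> be the boundary of \<open>f x\<close>.  The hypotheses identify \<open>a\<close> and \<open>b\<close> as the images of
  the source and the target of \<open>x\<close>.  Since \<open>A\<close> is the boundary of \<open>a\<close>, the remaining equation, for
  \<open>A\<close>, is the one given by the induction hypothesis for the source of \<open>x\<close>.
\<close>

lemma bdry_of_glob_hom:
  assumes X: "is_glob X" and C: "is_computad C"
    and cell: "\<And>n x. x \<in> gcells X n \<Longrightarrow> f n x \<in> cells C n"
    and src: "\<And>n x. x \<in> gcells X (Suc n) \<Longrightarrow> f n (gsrc X n x) = pr1 (bdry C (f (Suc n) x))"
    and tgt: "\<And>n x. x \<in> gcells X (Suc n) \<Longrightarrow> f n (gtgt X n x) = pr2 (bdry C (f (Suc n) x))"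
  shows "x \<in> gcells X n \<Longrightarrow> bdry C (f n x) = sphere_act f (att (Free X) n x)"
proof (induction n arbitrary: x)
  case 0
  from bdry_in_bspheres[OF C cell[OF this]] 0 show ?case by simp
next
  case (Suc n)
  note x = \<open>x \<in> gcells X (Suc n)\<close>
  from bdry_Suc[OF C cell[OF x]] obtain a b where ab: "bdry C (f (Suc n) x) = Sph (bdry C a) a b" .
  with src[OF x] tgt[OF x] have "a = f n (gsrc X n x)" "b = f n (gtgt X n x)" by simp_all
  with ab show ?case
    by (simp add: att_Free_Suc[OF X x] Suc.IH[OF glob_src[OF X x]])
qed

lemma hom_on_gens_Free_iff:
  assumes X: "is_glob X" and C: "is_computad C"
  shows "hom_on_gens (Free X) C f \<longleftrightarrow>
    (\<forall>n. \<forall>x\<in>gcells X n. f n x \<in> cells C n) \<and>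
    (\<forall>n. \<forall>x\<in>gcells X (Suc n). f n (gsrc X n x) = pr1 (bdry C (f (Suc n) x)) \<and>
       f n (gtgt X n x) = pr2 (bdry C (f (Suc n) x)))"
    (is "_ \<longleftrightarrow> ?R")
proof
  assume "hom_on_gens (Free X) C f"
  then show ?R
    by (simp add: hom_on_gens_def att_Free_Suc[OF X])
next
  assume ?R
  then show "hom_on_gens (Free X) C f"
    using bdry_of_glob_hom[OF X C, of f] by (simp add: hom_on_gens_def)
qed

definition adjunct ::
  "('u cell \<Rightarrow> 'u) \<Rightarrow> 'x glob \<Rightarrow> (nat \<Rightarrow> 'x \<Rightarrow> 'u cell) \<Rightarrow> nat \<Rightarrow> 'x \<Rightarrow> 'u" where
  "adjunct enc X h n = (\<lambda>x\<in>gcells X n. enc (h n x))"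

lemma adjunct_in_glob_hom_iff:
  assumes enc: "inj enc" and X: "is_glob X" and C: "is_computad C"
  shows "adjunct enc X h \<in> glob_hom X (rename enc (Cell C)) \<longleftrightarrow> hom_on_gens (Free X) C h"
  unfolding hom_on_gens_Free_iff[OF X C] glob_hom_iff
  by (auto simp: adjunct_def inj_image_mem_iff[OF enc] rename_src[OF enc] Cell_src
      glob_src[OF X] glob_tgt[OF X] inj_eq[OF enc])

lemma bij_betw_adjunct:
  assumes enc: "inj enc" and X: "is_glob X" and C: "is_computad C"
  shows "bij_betw (adjunct enc X) (comp_hom (Free X) C) (glob_hom X (rename enc (Cell C)))"
proof (rule bij_betw_imageI)
  show "inj_on (adjunct enc X) (comp_hom (Free X) C)"
  proof (rule inj_onI)
    fix g h
    assume gh: "g \<in> comp_hom (Free X) C" "h \<in> comp_hom (Free X) C"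
      and eq: "adjunct enc X g = adjunct enc X h"
    have "g n x = h n x" for n x
    proof (cases "x \<in> gcells X n")
      case True
      from fun_cong[OF fun_cong[OF eq], of n x] True show ?thesis
        by (simp add: adjunct_def inj_eq[OF enc])
    next
      case False
      then show ?thesis using gh by (simp add: comp_hom_iff)
    qed
    then show "g = h" by blast
  qed
  have "f \<in> adjunct enc X ` comp_hom (Free X) C" if f: "f \<in> glob_hom X (rename enc (Cell C))" for f
  proof -
    define h where "h = (\<lambda>n. \<lambda>x\<in>gcells X n. inv enc (f n x))"
    have "f n x \<in> range enc" if "x \<in> gcells X n" for n x
      using f that by (force simp: glob_hom_iff)
    then have eq: "f = adjunct enc X h"
      using f by (auto simp: glob_hom_iff adjunct_def h_def fun_eq_iff restrict_def
          intro!: f_inv_into_f[symmetric])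
    with f have "hom_on_gens (Free X) C h"
      using adjunct_in_glob_hom_iff[OF enc X C] by blast
    then have "h \<in> comp_hom (Free X) C"
      by (simp add: comp_hom_iff) (simp add: h_def)
    with eq show ?thesis by blast
  qed
  then show "adjunct enc X ` comp_hom (Free X) C = glob_hom X (rename enc (Cell C))"
    by (auto simp: adjunct_in_glob_hom_iff[OF enc X C] comp_hom_iff)
qed

theorem proposition4p1:
  fixes enc :: "'u cell \<Rightarrow> 'u"
  assumes "inj enc"
  shows "is_right_adjoint Glob Comp (Cell_functor enc) Free_functor"
proof -
  \<comment> \<open>Both sides send \<open>x\<close> to the code of the cell \<open>act \<sigma> (h n (f n x))\<close>.\<close>
  have natural: "adjunct enc X' (\<lambda>n. \<lambda>x\<in>gcells X' n.
        act (\<lambda>n. \<lambda>x\<in>gcells X n. act \<sigma> (h n x)) (Free_hom X' f n x)) =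
      (\<lambda>n. \<lambda>x\<in>gcells X' n. (\<lambda>x\<in>gcells X n.
         rename_hom enc (Cell C) (Cell_hom C \<sigma>) n (adjunct enc X h n x)) (f n x))"
    (is "?l = ?r")
    if f: "f \<in> glob_hom X' X" and h: "h \<in> comp_hom (Free X) C"
    for X X' :: "'u glob" and C :: "'u computad" and f h \<sigma>
  proof (intro ext)
    fix n x
    show "?l n x = ?r n x"
    proof (cases "x \<in> gcells X' n")
      case True
      then have "f n x \<in> gcells X n" using f by (simp add: glob_hom_iff)
      then show ?thesis
        using True comp_hom_cells[OF h, of "f n x" n] assms
        by (simp add: adjunct_def Free_hom_def Cell_hom_def)
    qed (simp add: adjunct_def)
  qed
  show ?thesis
    unfolding is_right_adjoint_def
    using is_functor_Free is_functor_Cell[OF assms]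
    by (intro conjI exI[of _ "\<lambda>X C. adjunct enc X"])
      (simp_all add: Glob_def Comp_def Free_functor_def Cell_functor_def natural
        bij_betw_adjunct[OF assms] del: restrict_apply)
qed

end
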